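(* For every partition $\lambda$ of $n$ with exactly $k$ parts equal to $1$, and every $j = 0,\dots, n-k$, $$Q_{\lambda,j} = Q_{\lambda, n-k-j}.$$
   Context: For $n\ge1$, $\mathfrak S_n$ is the symmetric group on $[n]=\{1,\dots,n\}$, and $\sigma\in\mathfrak S_n$ is written $\sigma_1\cdots\sigma_n$ with $\sigma_i=\sigma(i)$. $\mathrm{EXC}(\sigma)=\{i\in[n-1]:\sigma_i>i\}$, $\mathrm{exc}(\sigma)=|\mathrm{EXC}(\sigma)|$, and $\lambda(\sigma)$ is the cycle type of $\sigma$. Totally order the alphabet $[n]\cup\{\bar1,\dots,\bar n\}$ by $\bar1<\cdots<\bar n<1<\cdots<n$. Let $\bar\sigma$ be the word obtained from $\sigma_1\cdots\sigma_n$ by replacing $\sigma_i$ with $\overline{\sigma_i}$ for each $i\in\mathrm{EXC}(\sigma)$, and let $\mathrm{DEX}(\sigma)$ be the set of $i\in[n-1]$ such that the $i$th letter of $\bar\sigma$ is larger than the $(i+1)$st. For $S\subseteq[n-1]$, $F_{S,n}(\mathbf x)=\sum x_{i_1}\cdots x_{i_n}$, summed over all $i_1\ge\cdots\ge i_n\ge1$ with $i_j>i_{j+1}$ whenever $j\in S$. For $\lambda\vdash n$ and $j\ge0$, $Q_{\lambda,j}=\sum F_{\mathrm{DEX}(\sigma),n}$, summed over $\sigma\in\mathfrak S_n$ with $\mathrm{exc}(\sigma)=j$ and $\lambda(\sigma)=\lambda$ (an empty sum is $0$). *)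

theory Defs
  imports "HOL-Combinatorics.Permutations" "HOL-Combinatorics.Orbits"
    "HOL-Library.Multiset" "HOL-Library.FuncSet"
begin

text \<open>
  Elements of the symmetric group on \<open>[n]\<close> are the functions \<open>\<sigma> :: nat \<Rightarrow> nat\<close> with
  \<open>\<sigma> permutes {1..n}\<close>, and \<open>[n - 1]\<close> is \<open>{1..<n}\<close>.
\<close>

definition EXC :: "nat \<Rightarrow> (nat \<Rightarrow> nat) \<Rightarrow> nat set" where
  "EXC n \<sigma> = {i \<in> {1..<n}. \<sigma> i > i}"

definition exc :: "nat \<Rightarrow> (nat \<Rightarrow> nat) \<Rightarrow> nat" where
  "exc n \<sigma> = card (EXC n \<sigma>)"

text \<open>The cycles, fixed points included, are the orbits on \<open>[n]\<close>; each orbit is counted once.\<close>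

definition cycle_type :: "nat \<Rightarrow> (nat \<Rightarrow> nat) \<Rightarrow> nat multiset" where
  "cycle_type n \<sigma> = image_mset card (mset_set (orbit \<sigma> ` {1..n}))"

definition partition_of :: "nat multiset \<Rightarrow> nat \<Rightarrow> bool" where
  "partition_of lam n \<longleftrightarrow> (\<forall>p \<in># lam. p \<ge> 1) \<and> sum_mset lam = n"

datatype letter = Barred nat | Plain nat

instantiation letter :: linorder
begin

fun less_letter :: "letter \<Rightarrow> letter \<Rightarrow> bool" where
  "Barred a < Barred b \<longleftrightarrow> a < b"
| "Barred a < Plain b \<longleftrightarrow> True"
| "Plain a < Barred b \<longleftrightarrow> False"
| "Plain a < Plain b \<longleftrightarrow> a < b"

definition less_eq_letter :: "letter \<Rightarrow> letter \<Rightarrow> bool" where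
  "less_eq_letter x y \<longleftrightarrow> x < y \<or> x = y"

instance
proof
  fix x y z :: letter
  show "x < y \<longleftrightarrow> x \<le> y \<and> \<not> y \<le> x"
    by (cases x; cases y) (auto simp: less_eq_letter_def)
  show "x \<le> x"
    by (simp add: less_eq_letter_def)
  show "x \<le> y \<Longrightarrow> y \<le> z \<Longrightarrow> x \<le> z"
    by (cases x; cases y; cases z) (auto simp: less_eq_letter_def)
  show "x \<le> y \<Longrightarrow> y \<le> x \<Longrightarrow> x = y"
    by (cases x; cases y) (auto simp: less_eq_letter_def)
  show "x \<le> y \<or> y \<le> x"
    by (cases x; cases y) (auto simp: less_eq_letter_def)
qed

end

definition bar_word :: "nat \<Rightarrow> (nat \<Rightarrow> nat) \<Rightarrow> nat \<Rightarrow> letter" where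
  "bar_word n \<sigma> i = (if i \<in> EXC n \<sigma> then Barred (\<sigma> i) else Plain (\<sigma> i))"

definition DEX :: "nat \<Rightarrow> (nat \<Rightarrow> nat) \<Rightarrow> nat set" where
  "DEX n \<sigma> = {i \<in> {1..<n}. bar_word n \<sigma> i > bar_word n \<sigma> (i + 1)}"

text \<open>
  A formal power series in \<open>x\<^sub>1, x\<^sub>2, \<dots>\<close> over the integers is given by its coefficients. The
  monomial \<open>x\<^bsub>a\<^esub> x\<^bsub>b\<^esub> \<dots>\<close> is the multiset of the indices \<open>a, b, \<dots>\<close> of its factors.
\<close>

type_synonym power_series = "nat multiset \<Rightarrow> int"

definition F_seqs :: "nat set \<Rightarrow> nat \<Rightarrow> (nat \<Rightarrow> nat) set" where
  "F_seqs S n = {i \<in> {1..n} \<rightarrow>\<^sub>E {1..}.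
     (\<forall>j\<in>{1..<n}. i j \<ge> i (j + 1)) \<and> (\<forall>j\<in>S. i j > i (j + 1))}"

text \<open>
  In the sum of the monomials \<open>x\<^bsub>i 1\<^esub> \<dots> x\<^bsub>i n\<^esub>\<close> over \<open>F_seqs S n\<close>, the coefficient of \<open>m\<close> is the
  number of sequences with monomial \<open>m\<close>; this number is finite by \<open>finite_F_seqs_monomial\<close> below.
\<close>

definition F :: "nat set \<Rightarrow> nat \<Rightarrow> power_series" where
  "F S n = (\<lambda>m. int (card {i \<in> F_seqs S n. image_mset i (mset_set {1..n}) = m}))"

lemma finite_F_seqs_monomial:
  "finite {i \<in> F_seqs S n. image_mset i (mset_set {1..n}) = m}"
proof (rule finite_subset)
  show "{i \<in> F_seqs S n. image_mset i (mset_set {1..n}) = m} \<subseteq> {1..n} \<rightarrow>\<^sub>E set_mset m"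
    by (auto simp: F_seqs_def PiE_def)
  show "finite ({1..n} \<rightarrow>\<^sub>E set_mset m)"
    by (intro finite_PiE) auto
qed

definition Q :: "nat \<Rightarrow> nat multiset \<Rightarrow> nat \<Rightarrow> power_series" where
  "Q n lam j = (\<lambda>m. \<Sum>\<sigma> | \<sigma> permutes {1..n} \<and> exc n \<sigma> = j \<and> cycle_type n \<sigma> = lam. F (DEX n \<sigma>) n m)"

end

theory Submission
  imports Defs Complex_Main "HOL-Combinatorics.Cycles"
begin

text \<open>
  Compare coefficients of one monomial. Fix a weakly decreasing sequence \<open>s\<close> on \<open>[n]\<close> and call
  \<open>\<sigma>\<close> compatible with \<open>s\<close> if \<open>s\<close> drops strictly at every element of \<open>DEX \<sigma>\<close>. After exchanging the
  two summations, the claim is that as many permutations of cycle type \<open>\<lambda>\<close> compatible with \<open>s\<close>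
  have \<open>j\<close> excedances as have \<open>n - k - j\<close> of them.

  Give the position \<open>i\<close> the letter \<open>s i\<close>, barred if \<open>\<sigma> i > i\<close>. The cycles of \<open>\<sigma>\<close> become
  circular words in which a barred letter is followed by a letter at most as large, an unbarred one by
  a letter at least as large. In the spirit of Gessel and Reutenauer, a compatible \<open>\<sigma>\<close> can be
  recovered from the multiset of these words: order the letters by decreasing value with barred
  before unbarred, and read from each position the infinite periodic word along \<open>\<sigma>\<close>. Compatibility
  says that the positions are in lexicographic order of their words and that \<open>\<sigma>\<close> is increasing on
  ties (\<open>compatible_iso_unique\<close>). Conversely, any system of aperiodic circular words can be
  realised by sorting its positions in this way (\<open>compatible_iso_exists\<close>). Aperiodicity is what
  turns bars into excedances: the word of a barred position precedes that of its successor, for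
  otherwise all letters of the cycle would be equal.

  A bar may be seen as marking an edge of the circular word as descending. Reading the words
  backwards swaps descending and ascending edges and leaves the letters as they are, hence replaces
  \<open>j\<close> bars by \<open>n - k - j\<close>, the \<open>k\<close> fixed points being unbarred in both readings. On permutations
  this is \<open>\<sigma> \<mapsto> \<sigma>\<^sup>-\<^sup>1\<close>, followed by the conjugation that sorts the positions again. Since
  the content of the words is preserved, the symmetry holds separately for each \<open>s\<close>.

  The lexicographic order of infinite words is encoded by real numbers: a word is the sequence of
  digits of a number in a large base.
\<close>

section \<open>Itineraries as real numbers\<close>

definition itinerary_value :: "nat \<Rightarrow> ('a \<Rightarrow> 'a) \<Rightarrow> ('a \<Rightarrow> nat) \<Rightarrow> 'a \<Rightarrow> real" where
  "itinerary_value B f c i = (\<Sum>k. real (c ((f ^^ k) i)) / real B ^ Suc k)"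

text \<open>
  No digit equals \<open>B - 1\<close>, so that values stay strictly below 1 and two different digit sequences
  never represent the same number.
\<close>

locale itinerary =
  fixes A :: "'a set" and B :: nat and f :: "'a \<Rightarrow> 'a" and c :: "'a \<Rightarrow> nat"
  assumes closed: "i \<in> A \<Longrightarrow> f i \<in> A"
    and bound: "i \<in> A \<Longrightarrow> c i + 2 \<le> B"
begin

abbreviation x :: "'a \<Rightarrow> real" where
  "x \<equiv> itinerary_value B f c"

lemma closed_funpow: "i \<in> A \<Longrightarrow> (f ^^ k) i \<in> A"
  by (induction k) (auto intro: closed)

lemma base_ge_2: "i \<in> A \<Longrightarrow> B \<ge> 2"
  using bound[of i] by simp

lemma digit_sums:
  assumes "i \<in> A"
  shows "(\<lambda>k. real (B - 2) / real B ^ Suc k) sums (real (B - 2) / real (B - 1))"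
proof -
  have B: "B \<ge> 2" using base_ge_2[OF assms] .
  have "(\<lambda>k. (1 / real B) ^ k) sums (1 / (1 - 1 / real B))"
    by (rule geometric_sums) (use B in auto)
  then have "(\<lambda>k. real (B - 2) / real B * (1 / real B) ^ k) sums
      (real (B - 2) / real B * (1 / (1 - 1 / real B)))"
    by (rule sums_mult)
  moreover have "real (B - 2) / real B * (1 / (1 - 1 / real B)) = real (B - 2) / real (B - 1)"
    using B by (simp add: field_simps of_nat_diff)
  ultimately have "(\<lambda>k. real (B - 2) / real B * (1 / real B) ^ k) sums (real (B - 2) / real (B - 1))"
    by (simp only:)
  then show ?thesis by (simp add: power_one_over)
qed

lemma digit_le:
  assumes "i \<in> A"
  shows "real (c ((f ^^ k) i)) / real B ^ Suc k \<le> real (B - 2) / real B ^ Suc k"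
proof -
  have "c ((f ^^ k) i) \<le> B - 2" using bound[OF closed_funpow[OF assms, of k]] by simp
  then show ?thesis by (intro divide_right_mono) auto
qed

lemma summable_digits:
  assumes "i \<in> A"
  shows "summable (\<lambda>k. real (c ((f ^^ k) i)) / real B ^ Suc k)"
  by (rule summable_comparison_test'[OF sums_summable[OF digit_sums[OF assms]], of 0])
    (use digit_le[OF assms] in auto)

lemma value_nonneg: "i \<in> A \<Longrightarrow> 0 \<le> x i"
  unfolding itinerary_value_def by (intro suminf_nonneg summable_digits) auto

lemma value_less_1:
  assumes "i \<in> A"
  shows "x i < 1"
proof -
  have "x i \<le> real (B - 2) / real (B - 1)"
    unfolding itinerary_value_def sums_unique[OF digit_sums[OF assms]]
    by (intro suminf_le digit_le summable_digits sums_summable[OF digit_sums]) (use assms in auto)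
  also have "\<dots> < 1" using base_ge_2[OF assms] by simp
  finally show ?thesis .
qed

lemma value_unfold:
  assumes "i \<in> A"
  shows "real B * x i = real (c i) + x (f i)"
proof -
  have B: "B \<ge> 2" using base_ge_2[OF assms] .
  note sm = summable_digits[OF assms]
  have "x i = (\<Sum>k. real (c ((f ^^ Suc k) i)) / real B ^ Suc (Suc k)) + real (c i) / real B"
    unfolding itinerary_value_def using suminf_split_head[OF sm] by simp
  also have "(\<Sum>k. real (c ((f ^^ Suc k) i)) / real B ^ Suc (Suc k)) =
      (\<Sum>k. real (c ((f ^^ k) (f i))) / real B ^ Suc k / real B)"
    by (simp add: funpow_swap1 field_simps)
  also have "\<dots> = x (f i) / real B"
    unfolding itinerary_value_def by (rule suminf_divide[OF summable_digits[OF closed[OF assms]]])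
  finally show ?thesis using B by (simp add: field_simps)
qed

text \<open>
  The order of the values is the lexicographic order of the digit sequences: by
  \<open>value_unfold\<close> the digit is the integral part of \<open>B\<close> times the value, and the remaining
  digits give the fractional part.
\<close>

lemma value_less_iff:
  assumes "i \<in> A" "j \<in> A"
  shows "x i < x j \<longleftrightarrow> c i < c j \<or> c i = c j \<and> x (f i) < x (f j)"
proof -
  have B: "0 < real B" using base_ge_2[OF assms(1)] by simp
  have *: "x i < x j \<longleftrightarrow> real (c i) + x (f i) < real (c j) + x (f j)"
    using value_unfold[OF assms(1)] value_unfold[OF assms(2)] B
    by (metis mult_less_cancel_left_pos)
  have b: "0 \<le> x (f i)" "x (f i) < 1" "0 \<le> x (f j)" "x (f j) < 1"
    using assms by (auto intro: value_nonneg value_less_1 closed)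
  consider "c i < c j" | "c i = c j" | "c j < c i" by linarith
  then show ?thesis
  proof cases
    case 1
    then have "real (c i) + 1 \<le> real (c j)" by simp
    then show ?thesis using * b 1 by linarith
  next
    case 3
    then have "real (c j) + 1 \<le> real (c i)" by simp
    then show ?thesis using * b 3 by linarith
  qed (use * in auto)
qed

lemma value_eq_iff:
  assumes "i \<in> A" "j \<in> A"
  shows "x i = x j \<longleftrightarrow> c i = c j \<and> x (f i) = x (f j)"
  using value_less_iff[OF assms] value_less_iff[OF assms(2,1)]
  by (metis linorder_less_linear order_less_irrefl)

lemma value_eq_funpow:
  assumes "i \<in> A" "j \<in> A" "x i = x j"
  shows "x ((f ^^ k) i) = x ((f ^^ k) j)"
proof (induction k)
  case (Suc k)
  then show ?case using value_eq_iff[OF closed_funpow closed_funpow] assms by simp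
qed (use assms in simp)

end

section \<open>Permutations along their cycles\<close>

lemma permutes_funpow_eq_id:
  assumes "f permutes A" "finite A"
  obtains N where "N > 0" "f ^^ N = id"
proof -
  have "permutation f" using assms by (auto simp: permutation_permutes)
  then show ?thesis using permutation_is_nilpotent that by blast
qed

text \<open>
  An itinerary looks forward only. On a finite set the inverse is a power, so the itinerary also
  determines the letters read backwards.
\<close>

lemma inv_eq_funpow:
  assumes "f permutes A" "finite A"
  obtains r where "inv f = f ^^ r"
proof -
  obtain N where N: "N > 0" "f ^^ N = id" using permutes_funpow_eq_id[OF assms] .
  have "f ^^ (N - 1) \<circ> f = id"
    using N by (metis Suc_diff_1 funpow_Suc_right)
  then have "inv f = f ^^ (N - 1)"
    by (metis assms(1) comp_assoc comp_id id_comp permutes_inv_o(1))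
  then show ?thesis using that by blast
qed

lemma inv_funpow_eq_funpow:
  assumes "f permutes A" "finite A"
  obtains r where "f ^^ m = inv f ^^ r"
proof -
  obtain r where r: "inv (inv f) = inv f ^^ r"
    using inv_eq_funpow[OF permutes_inv[OF assms(1)] assms(2)] .
  then have "f ^^ m = inv f ^^ (r * m)"
    by (metis permutes_inv_inv[OF assms(1)] funpow_mult mult.commute)
  then show ?thesis using that by blast
qed

text \<open>
  A function that never increases along a cycle is constant on it, since the cycle closes up.
\<close>

lemma descending_on_cycle_imp_eq:
  fixes g :: "'a \<Rightarrow> 'b::order"
  assumes "f permutes A" "finite A"
    and desc: "\<And>k. g ((f ^^ Suc k) i) \<le> g ((f ^^ k) i)"
  shows "g (f i) = g i"
proof -
  obtain N where N: "N > 0" "f ^^ N = id" using permutes_funpow_eq_id[OF assms(1,2)] .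
  have "antimono (\<lambda>k. g ((f ^^ k) i))" using desc by (simp add: antimono_iff_le_Suc)
  then have "g ((f ^^ N) i) \<le> g ((f ^^ 1) i)" using antimonoD[of _ 1 N] N(1) by fastforce
  then show ?thesis using desc[of 0] N(2) by (auto intro: antisym)
qed

lemma ascending_on_cycle_imp_eq:
  fixes g :: "'a \<Rightarrow> 'b::order"
  assumes "f permutes A" "finite A"
    and asc: "\<And>k. g ((f ^^ k) i) \<le> g ((f ^^ Suc k) i)"
  shows "g (f i) = g i"
proof -
  obtain N where N: "N > 0" "f ^^ N = id" using permutes_funpow_eq_id[OF assms(1,2)] .
  have "mono (\<lambda>k. g ((f ^^ k) i))" using asc by (simp add: mono_iff_le_Suc)
  then have "g ((f ^^ 1) i) \<le> g ((f ^^ N) i)" using monoD[of _ 1 N] N(1) by fastforce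
  then show ?thesis using asc[of 0] N(2) by (auto intro: antisym)
qed

lemma orbit_conjugate:
  assumes "bij \<rho>"
  shows "orbit (\<rho> \<circ> f \<circ> inv \<rho>) (\<rho> i) = \<rho> ` orbit f i"
proof -
  have inv: "inv \<rho> (\<rho> y) = y" for y using assms by (simp add: bij_is_inj)
  show ?thesis
  proof (intro equalityI subsetI)
    fix y assume "y \<in> orbit (\<rho> \<circ> f \<circ> inv \<rho>) (\<rho> i)"
    then show "y \<in> \<rho> ` orbit f i"
      by induction (auto simp: inv intro: orbit.intros)
  next
    fix y assume "y \<in> \<rho> ` orbit f i"
    then obtain z where z: "z \<in> orbit f i" "y = \<rho> z" by blast
    from z(1) have "\<rho> z \<in> orbit (\<rho> \<circ> f \<circ> inv \<rho>) (\<rho> i)"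
    proof induction
      case base
      show ?case using orbit.base[of "\<rho> \<circ> f \<circ> inv \<rho>" "\<rho> i"] by (simp add: comp_def inv)
    next
      case (step z)
      show ?case using orbit.step[OF step.IH] by (simp add: comp_def inv)
    qed
    then show "y \<in> orbit (\<rho> \<circ> f \<circ> inv \<rho>) (\<rho> i)" using z by simp
  qed
qed

lemma cycle_type_conjugate:
  assumes "\<rho> permutes {1..n}"
  shows "cycle_type n (\<rho> \<circ> f \<circ> inv \<rho>) = cycle_type n f"
proof -
  have bij: "bij \<rho>" using assms by (rule permutes_bij)
  have inj: "inj_on (image \<rho>) X" for X
    by (intro inj_onI) (use bij in \<open>simp add: bij_is_inj inj_image_eq_iff\<close>)
  have "orbit (\<rho> \<circ> f \<circ> inv \<rho>) ` {1..n} = orbit (\<rho> \<circ> f \<circ> inv \<rho>) ` \<rho> ` {1..n}"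
    using permutes_image[OF assms] by simp
  also have "\<dots> = image \<rho> ` orbit f ` {1..n}"
    by (simp add: image_image orbit_conjugate[OF bij])
  finally have "cycle_type n (\<rho> \<circ> f \<circ> inv \<rho>) =
      image_mset card (image_mset (image \<rho>) (mset_set (orbit f ` {1..n})))"
    by (simp add: cycle_type_def image_mset_mset_set[OF inj])
  also have "\<dots> = cycle_type n f"
    using bij by (simp add: cycle_type_def multiset.map_comp o_def card_image bij_is_inj
        inj_on_subset[of _ UNIV])
  finally show ?thesis .
qed

lemma cycle_type_inv:
  assumes "\<sigma> permutes {1..n}"
  shows "cycle_type n (inv \<sigma>) = cycle_type n \<sigma>"
proof -
  have "permutation \<sigma>" using assms by (auto simp: permutation_permutes)
  then show ?thesis by (simp add: cycle_type_def orbit_inv_eq)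
qed

lemma card_orbit_eq_1_iff:
  assumes "\<sigma> permutes A" "finite A"
  shows "card (orbit \<sigma> i) = 1 \<longleftrightarrow> \<sigma> i = i"
proof
  have "permutation \<sigma>" using assms by (auto simp: permutation_permutes)
  then have self: "i \<in> orbit \<sigma> i" by (rule permutation_self_in_orbit)
  assume "card (orbit \<sigma> i) = 1"
  then show "\<sigma> i = i" using self orbit.base[of \<sigma> i] by (auto simp: card_1_singleton_iff)
next
  assume "\<sigma> i = i"
  then have "orbit \<sigma> i = {i}" by (simp add: orbit_eq_singleton_iff)
  then show "card (orbit \<sigma> i) = 1" by simp
qed

lemma count_cycle_type_1:
  assumes "\<sigma> permutes {1..n}"
  shows "count (cycle_type n \<sigma>) 1 = card {i \<in> {1..n}. \<sigma> i = i}"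
proof -
  have "count (cycle_type n \<sigma>) 1 = card {C \<in> orbit \<sigma> ` {1..n}. card C = 1}"
    unfolding cycle_type_def count_image_mset by (simp add: Int_def vimage_def conj_commute)
  also have "{C \<in> orbit \<sigma> ` {1..n}. card C = 1} = orbit \<sigma> ` {i \<in> {1..n}. \<sigma> i = i}"
    using card_orbit_eq_1_iff[OF assms] by auto
  also have "\<dots> = (\<lambda>i. {i}) ` {i \<in> {1..n}. \<sigma> i = i}"
    by (intro image_cong) (auto simp: orbit_eq_singleton_iff)
  also have "card \<dots> = card {i \<in> {1..n}. \<sigma> i = i}"
    by (intro card_image) auto
  finally show ?thesis .
qed

lemma mem_EXC_iff:
  assumes "\<sigma> permutes {1..n}" "i \<in> {1..n}"
  shows "i \<in> EXC n \<sigma> \<longleftrightarrow> \<sigma> i > i"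
proof -
  have "\<sigma> i \<in> {1..n}" using assms by (simp only: permutes_in_image)
  then show ?thesis using assms(2) by (auto simp: EXC_def)
qed

lemma EXC_eq:
  assumes "\<sigma> permutes {1..n}"
  shows "EXC n \<sigma> = {i \<in> {1..n}. \<sigma> i > i}"
  using mem_EXC_iff[OF assms] by (auto simp: EXC_def)

text \<open>
  The excedances of the inverse are the images of the anti-excedances.
\<close>

lemma exc_inv:
  assumes "\<sigma> permutes {1..n}"
  shows "exc n (inv \<sigma>) = n - count (cycle_type n \<sigma>) 1 - exc n \<sigma>"
proof -
  let ?fix = "{i \<in> {1..n}. \<sigma> i = i}" and ?exc = "{i \<in> {1..n}. \<sigma> i > i}"
    and ?anti = "{i \<in> {1..n}. \<sigma> i < i}"
  have "EXC n (inv \<sigma>) = \<sigma> ` ?anti"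
  proof (intro equalityI subsetI)
    fix i assume "i \<in> EXC n (inv \<sigma>)"
    then have i: "i \<in> {1..n}" "inv \<sigma> i > i" using EXC_eq[OF permutes_inv[OF assms]] by auto
    then have "inv \<sigma> i \<in> ?anti" "i = \<sigma> (inv \<sigma> i)"
      using permutes_in_image[OF permutes_inv[OF assms]] permutes_inverses[OF assms] by auto
    then show "i \<in> \<sigma> ` ?anti" by blast
  next
    fix i assume "i \<in> \<sigma> ` ?anti"
    then show "i \<in> EXC n (inv \<sigma>)"
      using EXC_eq[OF permutes_inv[OF assms]] permutes_in_image[OF assms]
        permutes_inverses[OF assms] by auto
  qed
  then have "exc n (inv \<sigma>) = card ?anti"
    using permutes_inj[OF assms] by (simp add: exc_def card_image inj_on_subset[of _ UNIV])
  moreover have "n = card (?fix \<union> (?exc \<union> ?anti))"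
  proof -
    have "?fix \<union> (?exc \<union> ?anti) = {1..n}" by auto
    then show ?thesis by simp
  qed
  then have "n = card ?fix + (card ?exc + card ?anti)"
    by (subst (asm) card_Un_disjoint; (subst (asm) card_Un_disjoint)?) auto
  ultimately show ?thesis
    unfolding count_cycle_type_1[OF assms] exc_def EXC_eq[OF assms] by linarith
qed

section \<open>Sorting\<close>

text \<open>
  Two monotone rearrangements of the same values coincide. If \<open>f i < g i\<close>, then the values of \<open>g\<close>
  on \<open>{i..n}\<close> all exceed \<open>f i\<close>, so \<open>p\<close> maps \<open>{i..n}\<close> injectively into itself and avoids \<open>i\<close>.
\<close>

lemma mono_rearrangement_unique:
  fixes f g :: "nat \<Rightarrow> 'b::linorder"
  assumes f: "\<And>i j. i \<in> {1..n} \<Longrightarrow> j \<in> {1..n} \<Longrightarrow> i \<le> j \<Longrightarrow> f i \<le> f j"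
    and g: "\<And>i j. i \<in> {1..n} \<Longrightarrow> j \<in> {1..n} \<Longrightarrow> i \<le> j \<Longrightarrow> g i \<le> g j"
    and p: "p permutes {1..n}" "\<And>i. i \<in> {1..n} \<Longrightarrow> f (p i) = g i"
    and i: "i \<in> {1..n}"
  shows "f i = g i"
proof -
  have *: False
    if f: "\<And>i j. i \<in> {1..n} \<Longrightarrow> j \<in> {1..n} \<Longrightarrow> i \<le> j \<Longrightarrow> f i \<le> f j"
    and g: "\<And>i j. i \<in> {1..n} \<Longrightarrow> j \<in> {1..n} \<Longrightarrow> i \<le> j \<Longrightarrow> g i \<le> g j"
    and p: "p permutes {1..n}" "\<And>i. i \<in> {1..n} \<Longrightarrow> f (p i) = g i"
    and lt: "f i < g i" for f g :: "nat \<Rightarrow> 'b" and p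
  proof -
    have "p j \<in> {i..n}" if j: "j \<in> {i..n}" for j
    proof (rule ccontr)
      assume "p j \<notin> {i..n}"
      moreover have pj: "p j \<in> {1..n}" using permutes_in_image[OF p(1)] i j by auto
      ultimately have "p j \<le> i" by auto
      then have "f (p j) \<le> f i" using f pj i by blast
      moreover have "g i \<le> g j" using g i j by auto
      ultimately show False using p(2)[of j] lt i j by auto
    qed
    then have "p ` {i..n} \<subseteq> {i..n}" by blast
    then have "p ` {i..n} = {i..n}"
      using permutes_inj_on[OF p(1)] by (intro endo_inj_surj) auto
    then obtain j where "j \<in> {i..n}" "p j = i" using i by (metis atLeastAtMost_iff imageE order_refl)
    moreover from this have "f i = g j" using p(2)[of j] i by auto
    moreover have "g i \<le> g j" using g i \<open>j \<in> {i..n}\<close> by auto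
    ultimately show False using lt by auto
  qed
  have "g (inv p j) = f j" if "j \<in> {1..n}" for j
    using p(2)[of "inv p j"] permutes_in_image[OF permutes_inv[OF p(1)]] that
      permutes_inverses[OF p(1)] by auto
  then have "\<not> g i < f i" using *[of g f "inv p"] g f permutes_inv[OF p(1)] by blast
  moreover have "\<not> f i < g i" using *[of f g p] f g p by blast
  ultimately show ?thesis by (metis linorder_neqE)
qed

lemma ranking_permutation:
  fixes less :: "nat \<Rightarrow> nat \<Rightarrow> bool"
  assumes irrefl: "\<And>i. \<not> less i i"
    and trans: "\<And>i j k. less i j \<Longrightarrow> less j k \<Longrightarrow> less i k"
    and total: "\<And>i j. i \<in> {1..n} \<Longrightarrow> j \<in> {1..n} \<Longrightarrow> i \<noteq> j \<Longrightarrow> less i j \<or> less j i"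
  obtains \<rho> where "\<rho> permutes {1..n}"
    "\<And>i j. i \<in> {1..n} \<Longrightarrow> j \<in> {1..n} \<Longrightarrow> \<rho> i < \<rho> j \<longleftrightarrow> less i j"
proof -
  define \<rho> where "\<rho> i = (if i \<in> {1..n} then Suc (card {j \<in> {1..n}. less j i}) else i)" for i
  have mono: "\<rho> i < \<rho> j" if "i \<in> {1..n}" "j \<in> {1..n}" "less i j" for i j
  proof -
    have "{k \<in> {1..n}. less k i} \<subset> {k \<in> {1..n}. less k j}"
      using that irrefl trans by blast
    then have "card {k \<in> {1..n}. less k i} < card {k \<in> {1..n}. less k j}"
      by (intro psubset_card_mono) auto
    then show ?thesis using that by (simp add: \<rho>_def)
  qed
  have inj: "inj_on \<rho> {1..n}"
    using mono total by (metis inj_onI order_less_irrefl)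
  have "\<rho> i \<in> {1..n}" if "i \<in> {1..n}" for i
  proof -
    have "{j \<in> {1..n}. less j i} \<subset> {1..n}" using that irrefl by blast
    then have "card {j \<in> {1..n}. less j i} < card {1..n}"
      by (intro psubset_card_mono) auto
    then show ?thesis using that by (simp add: \<rho>_def)
  qed
  then have "\<rho> ` {1..n} \<subseteq> {1..n}" by blast
  then have "\<rho> ` {1..n} = {1..n}" using inj by (intro endo_inj_surj) auto
  then have "\<rho> permutes {1..n}"
    using inj by (intro bij_imp_permutes) (auto simp: bij_betw_def \<rho>_def)
  moreover have "\<rho> i < \<rho> j \<longleftrightarrow> less i j" if "i \<in> {1..n}" "j \<in> {1..n}" for i j
    using mono that total by (metis order_less_asym order_less_irrefl)
  ultimately show ?thesis using that by blast
qed

section \<open>Permutations compatible with a weakly decreasing sequence\<close>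

locale decreasing_seq =
  fixes n :: nat and s :: "nat \<Rightarrow> nat"
  assumes decreasing: "i \<in> {1..n} \<Longrightarrow> j \<in> {1..n} \<Longrightarrow> i \<le> j \<Longrightarrow> s j \<le> s i"
begin

text \<open>
  The digits order the letters by decreasing value, barred before unbarred for equal values.
\<close>

definition letter_code :: "(nat \<Rightarrow> nat) \<Rightarrow> nat \<Rightarrow> nat" where
  "letter_code \<sigma> i = 2 * (s 1 - s i) + (if \<sigma> i > i then 0 else 1)"

abbreviation base :: nat where
  "base \<equiv> 2 * s 1 + 3"

abbreviation val :: "(nat \<Rightarrow> nat) \<Rightarrow> nat \<Rightarrow> real" where
  "val \<sigma> \<equiv> itinerary_value base \<sigma> (letter_code \<sigma>)"

definition compatible :: "(nat \<Rightarrow> nat) \<Rightarrow> bool" where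
  "compatible \<sigma> \<longleftrightarrow> (\<forall>i\<in>DEX n \<sigma>. s i > s (i + 1))"

text \<open>
  Compatibility is a lexicographic condition on consecutive positions, and the advantage of this
  form is that it is transitive.
\<close>

definition precedes :: "(nat \<Rightarrow> nat) \<Rightarrow> nat \<Rightarrow> nat \<Rightarrow> bool" where
  "precedes \<sigma> i j \<longleftrightarrow> letter_code \<sigma> i < letter_code \<sigma> j \<or> letter_code \<sigma> i = letter_code \<sigma> j \<and> \<sigma> i < \<sigma> j"

lemma itinerary_letter_code:
  assumes "\<sigma> permutes {1..n}"
  shows "itinerary {1..n} base \<sigma> (letter_code \<sigma>)"
proof
  show "\<sigma> i \<in> {1..n}" if "i \<in> {1..n}" for i
    using that permutes_in_image[OF assms] by blast
  show "letter_code \<sigma> i + 2 \<le> base" if "i \<in> {1..n}" for i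
    unfolding letter_code_def by (cases "\<sigma> i > i") auto
qed

lemma s_le_first: "i \<in> {1..n} \<Longrightarrow> s i \<le> s 1"
  using decreasing[of 1 i] by auto

lemma letter_code_le_imp:
  assumes "i \<in> {1..n}" "j \<in> {1..n}" "letter_code \<sigma> i \<le> letter_code \<tau> j"
  shows "s j \<le> s i"
  using assms(3) s_le_first[OF assms(1)] s_le_first[OF assms(2)] unfolding letter_code_def
  by (cases "\<sigma> i > i"; cases "\<tau> j > j"; simp only: if_True if_False; arith)

lemma letter_code_eq_iff:
  assumes "i \<in> {1..n}" "j \<in> {1..n}"
  shows "letter_code \<sigma> i = letter_code \<tau> j \<longleftrightarrow> s i = s j \<and> (\<sigma> i > i \<longleftrightarrow> \<tau> j > j)"
  using s_le_first[OF assms(1)] s_le_first[OF assms(2)] unfolding letter_code_def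
  by (cases "\<sigma> i > i"; cases "\<tau> j > j"; simp only: if_True if_False; arith)

lemma precedes_trans: "precedes \<sigma> i j \<Longrightarrow> precedes \<sigma> j k \<Longrightarrow> precedes \<sigma> i k"
  by (auto simp: precedes_def)

text \<open>
  Where \<open>s\<close> is constant, compatibility forbids descents of the barred word: within such a block the excedances come first, and \<open>\<sigma>\<close> increases on the
  excedances and on the other positions.
\<close>

lemma compatible_iff:
  assumes \<sigma>: "\<sigma> permutes {1..n}"
  shows "compatible \<sigma> \<longleftrightarrow> (\<forall>i\<in>{1..<n}. precedes \<sigma> i (i + 1))"
proof -
  have "(i \<in> DEX n \<sigma> \<longrightarrow> s i > s (i + 1)) \<longleftrightarrow> precedes \<sigma> i (i + 1)" if "i \<in> {1..<n}" for i
  proof -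
    have mem: "i \<in> {1..n}" "i + 1 \<in> {1..n}" using that by auto
    have "\<sigma> i \<noteq> \<sigma> (i + 1)" by (simp add: inj_eq[OF permutes_inj[OF \<sigma>]])
    moreover have "s 1 - s i \<le> s 1 - s (i + 1)"
      and "s (i + 1) < s i \<longleftrightarrow> s 1 - s i < s 1 - s (i + 1)"
      using decreasing[OF mem] s_le_first[OF mem(1)] by (simp_all add: diff_le_mono2 less_diff_iff) arith
    moreover have "i \<in> DEX n \<sigma> \<longleftrightarrow> bar_word n \<sigma> (i + 1) < bar_word n \<sigma> i"
      using that by (simp add: DEX_def)
    ultimately show ?thesis
      unfolding precedes_def letter_code_def bar_word_def mem_EXC_iff[OF \<sigma> mem(1)] mem_EXC_iff[OF \<sigma> mem(2)]
      by (cases "\<sigma> i > i"; cases "\<sigma> (i + 1) > i + 1") auto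
  qed
  moreover have "compatible \<sigma> \<longleftrightarrow> (\<forall>i\<in>{1..<n}. i \<in> DEX n \<sigma> \<longrightarrow> s i > s (i + 1))"
    unfolding compatible_def DEX_def by blast
  ultimately show ?thesis by blast
qed

lemma compatible_precedes:
  assumes "\<sigma> permutes {1..n}" "compatible \<sigma>"
    and "i \<in> {1..n}" "j \<in> {1..n}" "i < j"
  shows "precedes \<sigma> i j"
proof -
  have step: "precedes \<sigma> i (Suc i)" if "i \<in> {1..<n}" for i
    using assms(1,2) compatible_iff that by auto
  show ?thesis
    using assms(5) assms(3,4)
  proof (induction rule: strict_inc_induct)
    case (base i)
    then show ?case using step[of i] by auto
  next
    case (step i)
    then show ?case using \<open>\<And>i. i \<in> {1..<n} \<Longrightarrow> precedes \<sigma> i (Suc i)\<close>[of i]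
        precedes_trans by auto
  qed
qed

text \<open>
  If \<open>i < j\<close>, then either the first letters decide or \<open>\<sigma> i < \<sigma> j\<close> and the comparison is passed
  on to the images. Each time it is passed on, a wrong-way difference of values would be multiplied
  by the base, whereas all values lie between 0 and 1.
\<close>

lemma compatible_val_mono:
  assumes \<sigma>: "\<sigma> permutes {1..n}" "compatible \<sigma>"
    and ij: "i \<in> {1..n}" "j \<in> {1..n}" "i \<le> j"
  shows "val \<sigma> i \<le> val \<sigma> j"
proof -
  interpret itinerary "{1..n}" base \<sigma> "letter_code \<sigma>" using itinerary_letter_code[OF \<sigma>(1)] .
  \<comment> \<open>Each agreement of first letters improves the trivial bound 1 by a factor of the base.\<close>
  have bound: "x i - x j \<le> (1 / real base) ^ k" if "i \<in> {1..n}" "j \<in> {1..n}" "i < j" for i j k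
    using that
  proof (induction k arbitrary: i j)
    case 0
    then show ?case using value_less_1[of i] value_nonneg[of j] by simp
  next
    case (Suc k)
    note mem = Suc.prems(1,2)
    show ?case
    proof (cases "letter_code \<sigma> i < letter_code \<sigma> j")
      case True
      then have "x i < x j" using value_less_iff[OF mem] by simp
      moreover have "0 \<le> (1 / real base) ^ Suc k" by simp
      ultimately show ?thesis by linarith
    next
      case False
      then have eq: "letter_code \<sigma> i = letter_code \<sigma> j" and lt: "\<sigma> i < \<sigma> j"
        using compatible_precedes[OF \<sigma> Suc.prems] by (auto simp: precedes_def)
      have "real base * (x i - x j) = x (\<sigma> i) - x (\<sigma> j)"
        using value_unfold[OF mem(1)] value_unfold[OF mem(2)] eq by (simp add: right_diff_distrib)
      also have "\<dots> \<le> (1 / real base) ^ k"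
        by (rule Suc.IH[OF closed[OF mem(1)] closed[OF mem(2)] lt])
      finally have "real base * (x i - x j) \<le> (1 / real base) ^ k" .
      moreover have "0 < real base" by simp
      ultimately have "x i - x j \<le> (1 / real base) ^ k / real base"
        by (metis mult.commute pos_le_divide_eq)
      then show ?thesis by (simp only: power_Suc2 times_divide_eq_right mult_1_right)
    qed
  qed
  show ?thesis
  proof (rule ccontr)
    assume "\<not> ?thesis"
    then have "0 < x i - x j" "i < j" using ij(3) by (auto simp: order_less_le)
    then obtain k where "(1 / real base) ^ k < x i - x j"
      using real_arch_pow_inv[of "x i - x j" "1 / real base"] by auto
    then show False using bound[OF ij(1,2) \<open>i < j\<close>, of k] by linarith
  qed
qed

lemma compatible_less_on_ties:
  assumes \<sigma>: "\<sigma> permutes {1..n}" "compatible \<sigma>"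
    and ij: "i \<in> {1..n}" "j \<in> {1..n}" "val \<sigma> i = val \<sigma> j" "i < j"
  shows "\<sigma> i < \<sigma> j"
proof -
  interpret itinerary "{1..n}" base \<sigma> "letter_code \<sigma>" using itinerary_letter_code[OF \<sigma>(1)] .
  show ?thesis
    using compatible_precedes[OF \<sigma> ij(1,2,4)] value_eq_iff[OF ij(1,2)] ij(3)
    by (auto simp: precedes_def)
qed

text \<open>
  This says that the circular words along the cycles are primitive.
\<close>

definition aperiodic :: "(nat \<Rightarrow> nat) \<Rightarrow> bool" where
  "aperiodic \<sigma> \<longleftrightarrow>
     (\<forall>i\<in>{1..n}. \<forall>m. val \<sigma> ((\<sigma> ^^ m) i) = val \<sigma> i \<longrightarrow> (\<sigma> ^^ m) i = i)"

text \<open>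
  Positions with the same value keep their relative order under every power of \<open>\<sigma>\<close>. Hence if
  \<open>i\<close> and \<open>\<sigma>\<^sup>m i\<close> are different positions with the same value, then the iterates of \<open>\<sigma>\<^sup>m\<close> at \<open>i\<close>
  are strictly monotone, which is impossible on a finite cycle.
\<close>

lemma compatible_imp_aperiodic:
  assumes \<sigma>: "\<sigma> permutes {1..n}" "compatible \<sigma>"
  shows "aperiodic \<sigma>"
  unfolding aperiodic_def
proof (intro ballI allI impI)
  fix i m assume i: "i \<in> {1..n}" and eq: "val \<sigma> ((\<sigma> ^^ m) i) = val \<sigma> i"
  interpret itinerary "{1..n}" base \<sigma> "letter_code \<sigma>" using itinerary_letter_code[OF \<sigma>(1)] .
  have less: "(\<sigma> ^^ r) a < (\<sigma> ^^ r) b"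
    if "a \<in> {1..n}" "b \<in> {1..n}" "x a = x b" "a < b" for a b r
  proof (induction r)
    case (Suc r)
    then show ?case
      using compatible_less_on_ties[OF \<sigma> closed_funpow[OF that(1)] closed_funpow[OF that(2)]
          value_eq_funpow[OF that(1-3)]] by simp
  qed (use that in simp)
  define f where "f = \<sigma> ^^ m"
  have f: "f permutes {1..n}" unfolding f_def using \<sigma>(1) by (rule permutes_funpow)
  have f_funpow: "(f ^^ k) j = (\<sigma> ^^ (m * k)) j" for k j by (simp only: f_def funpow_mult)
  have f_Suc: "(f ^^ Suc k) j = (\<sigma> ^^ (m * k)) ((\<sigma> ^^ m) j)" for k j
    unfolding funpow_Suc_right comp_apply f_funpow by (simp only: f_def)
  have mem: "(\<sigma> ^^ m) i \<in> {1..n}" using i by (rule closed_funpow)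
  consider "(\<sigma> ^^ m) i = i" | "(\<sigma> ^^ m) i < i" | "i < (\<sigma> ^^ m) i" by linarith
  then show "(\<sigma> ^^ m) i = i"
  proof cases
    case 2
    have "(f ^^ Suc k) i < (f ^^ k) i" for k
      unfolding f_Suc f_funpow[of k] by (rule less[OF mem i eq 2])
    then have "id (f i) = id i"
      by (intro descending_on_cycle_imp_eq[OF f]) (auto intro: less_imp_le)
    then show ?thesis by (simp add: f_def)
  next
    case 3
    have "(f ^^ k) i < (f ^^ Suc k) i" for k
      unfolding f_Suc f_funpow[of k] by (rule less[OF i mem eq[symmetric] 3])
    then have "id (f i) = id i"
      by (intro ascending_on_cycle_imp_eq[OF f]) (auto intro: less_imp_le)
    then show ?thesis by (simp add: f_def)
  qed
qed

text \<open>
  Away from fixed points, \<open>\<sigma>\<close> has an excedance at \<open>a\<close> exactly if its inverse has none at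
  \<open>\<sigma> a\<close>. So the letters along a cycle of the inverse determine those along the
  same cycle of \<open>\<sigma>\<close>, and a period of the former is one of the latter.
\<close>

lemma aperiodic_inv:
  assumes \<sigma>: "\<sigma> permutes {1..n}" and ap: "aperiodic \<sigma>"
  shows "aperiodic (inv \<sigma>)"
  unfolding aperiodic_def
proof (intro ballI allI impI)
  let ?\<tau> = "inv \<sigma>"
  fix i m assume i: "i \<in> {1..n}" and eq: "val ?\<tau> ((?\<tau> ^^ m) i) = val ?\<tau> i"
  have \<tau>: "?\<tau> permutes {1..n}" using \<sigma> by (rule permutes_inv)
  interpret S: itinerary "{1..n}" base \<sigma> "letter_code \<sigma>" using itinerary_letter_code[OF \<sigma>] .
  interpret T: itinerary "{1..n}" base ?\<tau> "letter_code ?\<tau>" using itinerary_letter_code[OF \<tau>] .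
  define j where "j = (?\<tau> ^^ m) i"
  have j: "j \<in> {1..n}" unfolding j_def using i by (rule T.closed_funpow)
  have "(\<sigma> ^^ r) ((?\<tau> ^^ r) i) = i" for r
    by (induction r) (simp_all add: funpow_swap1[of \<sigma>] permutes_inverses[OF \<sigma>])
  then have return_m: "(\<sigma> ^^ m) j = i" by (simp add: j_def)
  have same_code: "letter_code ?\<tau> ((\<sigma> ^^ k) j) = letter_code ?\<tau> ((\<sigma> ^^ k) i)" for k
  proof -
    obtain r where "\<sigma> ^^ k = ?\<tau> ^^ r" using inv_funpow_eq_funpow[OF \<sigma>] by blast
    moreover have "val ?\<tau> ((?\<tau> ^^ r) j) = val ?\<tau> ((?\<tau> ^^ r) i)"
      using T.value_eq_funpow[OF j i] eq by (simp add: j_def)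
    ultimately show ?thesis
      using T.value_eq_iff[OF T.closed_funpow[OF j] T.closed_funpow[OF i]] by simp
  qed
  have fixed: "\<sigma> ((\<sigma> ^^ k) a) = (\<sigma> ^^ k) a \<longleftrightarrow> \<sigma> a = a" for k a
    using permutes_inj[OF permutes_funpow[OF \<sigma>]] by (metis funpow_swap1 injD)
  show "(?\<tau> ^^ m) i = i"
  proof (cases "\<sigma> j = j")
    case True
    then have "(\<sigma> ^^ m) j = j" by (induction m) auto
    then show ?thesis using return_m j_def by simp
  next
    case False
    then have False': "\<sigma> i \<noteq> i" using fixed[of m j] return_m by simp
    have "letter_code \<sigma> ((\<sigma> ^^ k) j) = letter_code \<sigma> ((\<sigma> ^^ k) i)" for k
    proof -
      note mem = S.closed_funpow[OF j, of k] S.closed_funpow[OF i, of k]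
      have ne: "\<sigma> ((\<sigma> ^^ k) j) \<noteq> (\<sigma> ^^ k) j" "\<sigma> ((\<sigma> ^^ k) i) \<noteq> (\<sigma> ^^ k) i"
        using fixed False False' by auto
      have "letter_code ?\<tau> (\<sigma> ((\<sigma> ^^ k) j)) = letter_code ?\<tau> (\<sigma> ((\<sigma> ^^ k) i))"
        using same_code[of "Suc k"] by simp
      then have "(\<sigma> ^^ k) j > \<sigma> ((\<sigma> ^^ k) j) \<longleftrightarrow> (\<sigma> ^^ k) i > \<sigma> ((\<sigma> ^^ k) i)"
        using letter_code_eq_iff[OF S.closed[OF mem(1)] S.closed[OF mem(2)]]
        by (simp add: permutes_inverses[OF \<sigma>])
      moreover have "s ((\<sigma> ^^ k) j) = s ((\<sigma> ^^ k) i)"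
        using same_code[of k] letter_code_eq_iff[OF mem] by blast
      ultimately show ?thesis using letter_code_eq_iff[OF mem] ne by auto
    qed
    then have "val \<sigma> j = val \<sigma> i" by (simp add: itinerary_value_def)
    then have "val \<sigma> ((\<sigma> ^^ m) j) = val \<sigma> j" using return_m by simp
    then have "(\<sigma> ^^ m) j = j" using ap j by (auto simp: aperiodic_def)
    then show ?thesis using return_m j_def by simp
  qed
qed

section \<open>Isomorphic permutations\<close>

text \<open>
  A relabelling of positions that carries the permutation, the sequence \<open>s\<close> and the bars of one
  permutation to those of the other. It exists exactly if both have the same multiset of circular
  words, so it stands in for that multiset.
\<close>

definition iso :: "(nat \<Rightarrow> nat) \<Rightarrow> (nat \<Rightarrow> nat) \<Rightarrow> (nat \<Rightarrow> nat) \<Rightarrow> bool" where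
  "iso \<rho> \<sigma> \<tau> \<longleftrightarrow> \<rho> permutes {1..n} \<and> \<rho> \<circ> \<sigma> = \<tau> \<circ> \<rho> \<and>
     (\<forall>i\<in>{1..n}. s (\<rho> i) = s i \<and> (\<tau> (\<rho> i) > \<rho> i \<longleftrightarrow> \<sigma> i > i))"

lemma iso_sym:
  assumes "iso \<rho> \<sigma> \<tau>"
  shows "iso (inv \<rho>) \<tau> \<sigma>"
proof -
  have \<rho>: "\<rho> permutes {1..n}" and comm: "\<rho> (\<sigma> i) = \<tau> (\<rho> i)" for i
    using assms by (auto simp: iso_def fun_eq_iff)
  have "inv \<rho> (\<tau> i) = \<sigma> (inv \<rho> i)" for i
    using comm[of "inv \<rho> i"] permutes_inverses[OF \<rho>] by metis
  moreover have "s (inv \<rho> i) = s i \<and> (\<sigma> (inv \<rho> i) > inv \<rho> i \<longleftrightarrow> \<tau> i > i)" if "i \<in> {1..n}" for i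
  proof -
    have "inv \<rho> i \<in> {1..n}" using that permutes_in_image[OF permutes_inv[OF \<rho>]] by blast
    then have "s (\<rho> (inv \<rho> i)) = s (inv \<rho> i) \<and>
        (\<tau> (\<rho> (inv \<rho> i)) > \<rho> (inv \<rho> i) \<longleftrightarrow> \<sigma> (inv \<rho> i) > inv \<rho> i)"
      using assms unfolding iso_def by blast
    then show ?thesis by (simp add: permutes_inverses[OF \<rho>])
  qed
  ultimately show ?thesis using permutes_inv[OF \<rho>] by (auto simp: iso_def fun_eq_iff)
qed

lemma iso_trans:
  assumes "iso \<rho> \<sigma> \<tau>" "iso \<rho>' \<tau> \<upsilon>"
  shows "iso (\<rho>' \<circ> \<rho>) \<sigma> \<upsilon>"
proof -
  have \<rho>: "\<rho> permutes {1..n}" using assms by (simp add: iso_def)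
  have "\<rho> i \<in> {1..n}" if "i \<in> {1..n}" for i
    using that permutes_in_image[OF \<rho>] by blast
  then show ?thesis using assms by (auto simp: iso_def fun_eq_iff intro: permutes_compose)
qed

text \<open>
  Inversion descends to circular words: the inverse is barred at \<open>\<sigma> a\<close> exactly if \<open>a\<close> is neither
  barred nor fixed, and both properties of \<open>a\<close> are carried over by \<open>\<rho>\<close>.
\<close>

lemma iso_inv:
  assumes iso: "iso \<rho> \<sigma> \<tau>" and \<sigma>: "\<sigma> permutes {1..n}" and \<tau>: "\<tau> permutes {1..n}"
  shows "iso \<rho> (inv \<sigma>) (inv \<tau>)"
proof -
  have \<rho>: "\<rho> permutes {1..n}" and comm: "\<rho> (\<sigma> i) = \<tau> (\<rho> i)" for i
    using iso by (auto simp: iso_def fun_eq_iff)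
  have inv: "\<rho> (inv \<sigma> i) = inv \<tau> (\<rho> i)" for i
    using comm[of "inv \<sigma> i"] permutes_inverses[OF \<sigma>] permutes_inverses[OF \<tau>] by metis
  have "inv \<tau> (\<rho> i) > \<rho> i \<longleftrightarrow> inv \<sigma> i > i" if i: "i \<in> {1..n}" for i
  proof -
    define j where "j = inv \<sigma> i"
    have j: "j \<in> {1..n}" "i = \<sigma> j"
      using i permutes_in_image[OF permutes_inv[OF \<sigma>]] permutes_inverses[OF \<sigma>] by (auto simp: j_def)
    have "\<rho> j = \<rho> i \<longleftrightarrow> j = i" by (rule inj_eq[OF permutes_inj[OF \<rho>]])
    moreover have "\<rho> i > \<rho> j \<longleftrightarrow> i > j" using iso j comm by (auto simp: iso_def)
    moreover have "inv \<tau> (\<rho> i) = \<rho> j" using inv j_def by simp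
    ultimately show ?thesis unfolding j_def[symmetric] by (metis linorder_neqE_nat order_less_asym)
  qed
  then show ?thesis using iso inv by (simp add: iso_def fun_eq_iff)
qed

lemma iso_val:
  assumes iso: "iso \<rho> \<sigma> \<tau>" and \<sigma>: "\<sigma> permutes {1..n}" and i: "i \<in> {1..n}"
  shows "val \<tau> (\<rho> i) = val \<sigma> i"
proof -
  interpret itinerary "{1..n}" base \<sigma> "letter_code \<sigma>" using itinerary_letter_code[OF \<sigma>] .
  have "(\<tau> ^^ k) (\<rho> i) = \<rho> ((\<sigma> ^^ k) i)" for k
    using iso by (induction k) (auto simp: iso_def fun_eq_iff)
  moreover have "letter_code \<tau> (\<rho> j) = letter_code \<sigma> j" if "j \<in> {1..n}" for j
    using iso that by (auto simp: iso_def letter_code_def)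
  ultimately have "letter_code \<tau> ((\<tau> ^^ k) (\<rho> i)) = letter_code \<sigma> ((\<sigma> ^^ k) i)" for k
    using closed_funpow[OF i] by simp
  then show ?thesis by (simp add: itinerary_value_def)
qed

text \<open>
  The values are the same at every position, being sorted in both cases, and therefore so are
  the values at the images. What is left is the order within a tie class. There both permutations are
  increasing bijections onto the same tie class, and such a bijection is unique: at the first
  position \<open>i\<close> with \<open>f i < g i\<close>, the value \<open>f i\<close> of \<open>g\<close> would have to be taken before \<open>i\<close>, where
  \<open>f\<close> and \<open>g\<close> agree.
\<close>

lemma compatible_iso_unique:
  assumes iso: "iso \<rho> \<sigma> \<tau>"
    and \<sigma>: "\<sigma> permutes {1..n}" "compatible \<sigma>"
    and \<tau>: "\<tau> permutes {1..n}" "compatible \<tau>"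
  shows "\<sigma> = \<tau>"
proof -
  interpret S: itinerary "{1..n}" base \<sigma> "letter_code \<sigma>" using itinerary_letter_code[OF \<sigma>(1)] .
  interpret T: itinerary "{1..n}" base \<tau> "letter_code \<tau>" using itinerary_letter_code[OF \<tau>(1)] .
  have \<rho>: "\<rho> permutes {1..n}" using iso by (simp add: iso_def)
  have val_eq: "val \<tau> i = val \<sigma> i" if "i \<in> {1..n}" for i
    by (rule mono_rearrangement_unique[of n "val \<tau>" "val \<sigma>" \<rho>])
      (use compatible_val_mono[OF \<tau>] compatible_val_mono[OF \<sigma>] \<rho> iso_val[OF iso \<sigma>(1)] that in blast)+
  have next_eq: "val \<sigma> (\<sigma> i) = val \<sigma> (\<tau> i)" if i: "i \<in> {1..n}" for i
  proof -
    have eq: "real (letter_code \<tau> i) + val \<sigma> (\<tau> i) = real (letter_code \<sigma> i) + val \<sigma> (\<sigma> i)"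
      using S.value_unfold[OF i] T.value_unfold[OF i] val_eq[OF i] val_eq[OF T.closed[OF i]] by simp
    have "0 \<le> val \<sigma> (\<tau> i)" "val \<sigma> (\<tau> i) < 1" "0 \<le> val \<sigma> (\<sigma> i)" "val \<sigma> (\<sigma> i) < 1"
      using i S.closed T.closed S.value_nonneg S.value_less_1 by auto
    then have "real (letter_code \<tau> i) < real (letter_code \<sigma> i) + 1" "real (letter_code \<sigma> i) < real (letter_code \<tau> i) + 1"
      using eq by linarith+
    then have "letter_code \<tau> i = letter_code \<sigma> i" by linarith
    then show ?thesis using eq by simp
  qed
  have not_less: "\<not> f i < g i"
    if f: "f permutes {1..n}" and g: "g permutes {1..n}" "compatible g"
      and i: "i \<in> {1..n}" and nxt: "val g (f i) = val g (g i)"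
      and IH: "\<And>j. j \<in> {1..n} \<Longrightarrow> j < i \<Longrightarrow> f j = g j" for f g i
  proof
    assume less: "f i < g i"
    interpret G: itinerary "{1..n}" base g "letter_code g" using itinerary_letter_code[OF g(1)] .
    define j where "j = inv g (f i)"
    have gj: "g j = f i" by (simp add: j_def permutes_inverses[OF g(1)])
    have fi: "f i \<in> {1..n}" using permutes_in_image[OF f] i by blast
    have j: "j \<in> {1..n}"
      unfolding j_def using permutes_in_image[OF permutes_inv[OF g(1)]] fi by blast
    obtain r where r: "inv g = g ^^ r" using inv_eq_funpow[OF g(1)] by blast
    have "val g (inv g (f i)) = val g (inv g (g i))"
      unfolding r using G.value_eq_funpow[OF fi G.closed[OF i] nxt] .
    then have tie: "val g j = val g i" by (simp add: j_def permutes_inverses[OF g(1)])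
    have "j < i"
      using compatible_less_on_ties[OF g i j tie[symmetric]] gj less
      by (metis linorder_neqE_nat order_less_asym order_less_irrefl)
    then have "f j = f i" using IH[OF j] gj by simp
    then have "j = i" by (simp only: inj_eq[OF permutes_inj[OF f]])
    then show False using \<open>j < i\<close> by simp
  qed
  have "\<sigma> i = \<tau> i" if "i \<in> {1..n}" for i
    using that
  proof (induction i rule: less_induct)
    case (less i)
    have IH: "\<sigma> j = \<tau> j" if "j \<in> {1..n}" "j < i" for j using less.IH that by blast
    have "\<not> \<tau> i < \<sigma> i"
      by (rule not_less[OF \<tau>(1) \<sigma> less.prems]) (use next_eq[OF less.prems] IH in auto)
    moreover have "\<not> \<sigma> i < \<tau> i"
      by (rule not_less[OF \<sigma>(1) \<tau> less.prems])
        (use next_eq[OF less.prems] IH val_eq S.closed T.closed less.prems in auto)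
    ultimately show ?case by linarith
  qed
  then show ?thesis
    using permutes_not_in[OF \<sigma>(1)] permutes_not_in[OF \<tau>(1)] by (metis ext)
qed

text \<open>
  Otherwise, since \<open>s\<close> does not increase along a bar, the next letter is forced to be equal and
  barred as well, and the same comparison recurs at the next position. So the values never increase
  along the cycle; they are constant, and aperiodicity makes \<open>i\<close> a fixed point.
\<close>

lemma aperiodic_val_less_next:
  assumes \<tau>: "\<tau> permutes {1..n}" "aperiodic \<tau>" and i: "i \<in> {1..n}" and "\<tau> i > i"
  shows "val \<tau> i < val \<tau> (\<tau> i)"
proof (rule ccontr)
  interpret itinerary "{1..n}" base \<tau> "letter_code \<tau>" using itinerary_letter_code[OF \<tau>(1)] .
  assume "\<not> val \<tau> i < val \<tau> (\<tau> i)"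
  have "x ((\<tau> ^^ Suc k) i) \<le> x ((\<tau> ^^ k) i) \<and> (\<tau> ^^ k) i < (\<tau> ^^ Suc k) i" for k
  proof (induction k)
    case 0
    show ?case using \<open>\<not> val \<tau> i < val \<tau> (\<tau> i)\<close> \<open>\<tau> i > i\<close> by simp
  next
    case (Suc k)
    define j where "j = (\<tau> ^^ k) i"
    have j: "j \<in> {1..n}" unfolding j_def using i by (rule closed_funpow)
    have j': "\<tau> j \<in> {1..n}" using j by (rule closed)
    have IH: "x (\<tau> j) \<le> x j" "j < \<tau> j" using Suc.IH by (simp_all add: j_def)
    have "letter_code \<tau> (\<tau> j) \<le> letter_code \<tau> j" using IH(1) value_less_iff[OF j j'] by force
    moreover have "s (\<tau> j) \<le> s j" using decreasing j j' IH(2) by simp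
    ultimately have "letter_code \<tau> (\<tau> j) = letter_code \<tau> j \<and> \<tau> j < \<tau> (\<tau> j)"
      using IH(2) letter_code_le_imp[OF j' j] s_le_first[OF j] by (auto simp: letter_code_def split: if_splits)
    then show ?case using IH(1) value_less_iff[OF j j'] by (auto simp: j_def)
  qed
  then have "x (\<tau> i) = x i" by (intro descending_on_cycle_imp_eq[OF \<tau>(1)]) auto
  then have "\<tau> i = i" using \<tau>(2) i by (auto simp: aperiodic_def dest!: bspec spec[of _ 1])
  then show False using \<open>\<tau> i > i\<close> by simp
qed

lemma aperiodic_val_next_less:
  assumes \<tau>: "\<tau> permutes {1..n}" "aperiodic \<tau>" and i: "i \<in> {1..n}" and "\<tau> i < i"
  shows "val \<tau> (\<tau> i) < val \<tau> i"
proof (rule ccontr)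
  interpret itinerary "{1..n}" base \<tau> "letter_code \<tau>" using itinerary_letter_code[OF \<tau>(1)] .
  assume "\<not> val \<tau> (\<tau> i) < val \<tau> i"
  have "x ((\<tau> ^^ k) i) \<le> x ((\<tau> ^^ Suc k) i) \<and> (\<tau> ^^ Suc k) i \<le> (\<tau> ^^ k) i" for k
  proof (induction k)
    case 0
    show ?case using \<open>\<not> val \<tau> (\<tau> i) < val \<tau> i\<close> \<open>\<tau> i < i\<close> by simp
  next
    case (Suc k)
    define j where "j = (\<tau> ^^ k) i"
    have j: "j \<in> {1..n}" unfolding j_def using i by (rule closed_funpow)
    have j': "\<tau> j \<in> {1..n}" using j by (rule closed)
    have IH: "x j \<le> x (\<tau> j)" "\<tau> j \<le> j" using Suc.IH by (simp_all add: j_def)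
    have "letter_code \<tau> j \<le> letter_code \<tau> (\<tau> j)" using IH(1) value_less_iff[OF j' j] by force
    moreover have "s j \<le> s (\<tau> j)" using decreasing j j' IH(2) by simp
    ultimately have "letter_code \<tau> (\<tau> j) = letter_code \<tau> j \<and> \<tau> (\<tau> j) \<le> \<tau> j"
      using IH(2) letter_code_le_imp[OF j j'] s_le_first[OF j'] by (auto simp: letter_code_def split: if_splits)
    then show ?case using IH(1) value_less_iff[OF j' j] by (auto simp: j_def)
  qed
  then have "x (\<tau> i) = x i" by (intro ascending_on_cycle_imp_eq[OF \<tau>(1)]) auto
  then have "\<tau> i = i" using \<tau>(2) i by (auto simp: aperiodic_def dest!: bspec spec[of _ 1])
  then show False using \<open>\<tau> i < i\<close> by simp
qed

text \<open>
  Positions are ranked by their values. Ties occur between different cycles only, and are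
  broken by the least element of the cycle; as this is constant along cycles, \<open>\<tau>\<close> respects the order
  within tie classes. The new permutation has its excedances at the barred positions because the
  value strictly increases along bars and strictly decreases elsewhere except at fixed points.
\<close>

lemma compatible_iso_exists:
  assumes \<tau>: "\<tau> permutes {1..n}" "aperiodic \<tau>"
  obtains \<rho> where "iso \<rho> \<tau> (\<rho> \<circ> \<tau> \<circ> inv \<rho>)" "compatible (\<rho> \<circ> \<tau> \<circ> inv \<rho>)"
proof -
  interpret itinerary "{1..n}" base \<tau> "letter_code \<tau>" using itinerary_letter_code[OF \<tau>(1)] .
  have perm: "permutation \<tau>" using \<tau>(1) by (auto simp: permutation_permutes)
  define m where "m i = Min (orbit \<tau> i)" for i
  define less where "less i j \<longleftrightarrow> x i < x j \<or> x i = x j \<and> m i < m j" for i j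
  have m_next: "m (\<tau> i) = m i" for i
    unfolding m_def using permutation_orbit_step[OF perm] by simp
  \<comment> \<open>Equal least elements mean equal cycles, so aperiodicity makes \<open>less\<close> total.\<close>
  have same: "i = j" if ij: "i \<in> {1..n}" "x i = x j" "m i = m j" for i j
  proof -
    have fin: "finite (orbit \<tau> a)" for a
      using perm by (simp add: finite_orbit permutation_self_in_orbit)
    have "m i \<in> orbit \<tau> i" "m j \<in> orbit \<tau> j"
      unfolding m_def using Min_in[OF fin orbit_nonempty] by auto
    then have "j \<in> orbit \<tau> i"
      by (metis ij(3) orbit_swap orbit_trans perm permutation_self_in_orbit)
    then obtain r where "j = (\<tau> ^^ r) i" using orbit_altdef_permutation[OF perm] by blast
    then show ?thesis using \<tau>(2) ij(1,2) unfolding aperiodic_def by metis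
  qed
  obtain \<rho> where \<rho>: "\<rho> permutes {1..n}"
    and rank: "\<And>i j. i \<in> {1..n} \<Longrightarrow> j \<in> {1..n} \<Longrightarrow> \<rho> i < \<rho> j \<longleftrightarrow> less i j"
  proof (rule ranking_permutation[of less n])
    show "less i j \<or> less j i" if "i \<in> {1..n}" "j \<in> {1..n}" "i \<noteq> j" for i j
      using same[of i j] that linorder_less_linear[of "x i" "x j"] linorder_less_linear[of "m i" "m j"]
      unfolding less_def by metis
  qed (auto simp: less_def)
  define \<sigma> where "\<sigma> = \<rho> \<circ> \<tau> \<circ> inv \<rho>"
  have \<sigma>: "\<sigma> permutes {1..n}"
    unfolding \<sigma>_def
    by (rule permutes_compose[OF permutes_inv[OF \<rho>] permutes_compose[OF \<tau>(1) \<rho>]])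
  have \<sigma>\<rho>: "\<sigma> (\<rho> i) = \<rho> (\<tau> i)" for i
    by (simp add: \<sigma>_def permutes_inverses[OF \<rho>])
  have inv_mem: "inv \<rho> i \<in> {1..n}" if "i \<in> {1..n}" for i
    using that permutes_in_image[OF permutes_inv[OF \<rho>]] by blast
  have s_\<rho>: "s (\<rho> i) = s i" if i: "i \<in> {1..n}" for i
  proof -
    \<comment> \<open>Ranking sorts by letters first, so it rearranges the decreasing sequence \<open>s\<close> decreasingly and
      cannot change it; the sign turns this into a statement on monotone sequences.\<close>
    have dec: "- int (s (inv \<rho> a)) \<le> - int (s (inv \<rho> b))" if ab: "a \<in> {1..n}" "b \<in> {1..n}" "a \<le> b" for a b
    proof (cases "a = b")
      case False
      then have "less (inv \<rho> a) (inv \<rho> b)"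
        using rank[OF inv_mem[OF ab(1)] inv_mem[OF ab(2)]] ab(3) by (simp add: permutes_inverses[OF \<rho>])
      then have "letter_code \<tau> (inv \<rho> a) \<le> letter_code \<tau> (inv \<rho> b)"
        using value_less_iff value_eq_iff inv_mem ab by (fastforce simp: less_def)
      then show ?thesis using letter_code_le_imp[OF inv_mem[OF ab(1)] inv_mem[OF ab(2)]] by simp
    qed simp
    have "- int (s (inv \<rho> (\<rho> i))) = - int (s (\<rho> i))"
    proof (rule mono_rearrangement_unique[of n "\<lambda>a. - int (s (inv \<rho> a))" "\<lambda>a. - int (s a)" \<rho>])
      show "- int (s a) \<le> - int (s b)" if "a \<in> {1..n}" "b \<in> {1..n}" "a \<le> b" for a b
        using decreasing[OF that] by simp
      show "\<rho> i \<in> {1..n}" using i permutes_in_image[OF \<rho>] by blast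
    qed (use dec \<rho> in \<open>simp_all add: permutes_inverses[OF \<rho>]\<close>)
    then show ?thesis by (simp add: permutes_inverses[OF \<rho>])
  qed
  have exc: "\<sigma> (\<rho> i) > \<rho> i \<longleftrightarrow> \<tau> i > i" if i: "i \<in> {1..n}" for i
  proof -
    have "\<rho> i < \<rho> (\<tau> i) \<longleftrightarrow> x i < x (\<tau> i)"
      using rank[OF i closed[OF i]] by (simp add: less_def m_next)
    also have "\<dots> \<longleftrightarrow> \<tau> i > i"
      using aperiodic_val_less_next[OF \<tau> i] aperiodic_val_next_less[OF \<tau> i]
      by (metis linorder_neqE_nat order_less_asym order_less_irrefl)
    finally show ?thesis by (simp add: \<sigma>\<rho>)
  qed
  have iso: "iso \<rho> \<tau> \<sigma>"
    using \<rho> s_\<rho> exc by (simp add: iso_def fun_eq_iff \<sigma>\<rho>)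
  have code_\<sigma>: "letter_code \<sigma> (\<rho> i) = letter_code \<tau> i" if "i \<in> {1..n}" for i
    using that s_\<rho> exc by (simp add: letter_code_def)
  have "precedes \<sigma> a (a + 1)" if a: "a \<in> {1..<n}" for a
  proof -
    define i j where "i = inv \<rho> a" and "j = inv \<rho> (a + 1)"
    have ij: "i \<in> {1..n}" "j \<in> {1..n}" "\<rho> i = a" "\<rho> j = a + 1"
      using a inv_mem by (auto simp: i_def j_def permutes_inverses[OF \<rho>])
    have l: "less i j" using rank[OF ij(1,2)] ij by simp
    have "letter_code \<tau> i < letter_code \<tau> j \<or> letter_code \<tau> i = letter_code \<tau> j \<and> less (\<tau> i) (\<tau> j)"
      using l value_less_iff[OF ij(1,2)] value_eq_iff[OF ij(1,2)] by (auto simp: less_def m_next)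
    then have "letter_code \<sigma> (\<rho> i) < letter_code \<sigma> (\<rho> j) \<or> letter_code \<sigma> (\<rho> i) = letter_code \<sigma> (\<rho> j) \<and> \<sigma> (\<rho> i) < \<sigma> (\<rho> j)"
      using rank[OF closed[OF ij(1)] closed[OF ij(2)]] ij(1,2) by (simp add: code_\<sigma> \<sigma>\<rho>)
    then show ?thesis by (simp add: precedes_def ij)
  qed
  then have "compatible \<sigma>" using compatible_iff[OF \<sigma>] by blast
  then show ?thesis using that iso by (simp add: \<sigma>_def)
qed

section \<open>Counting\<close>

definition compatible_perms :: "nat multiset \<Rightarrow> nat \<Rightarrow> (nat \<Rightarrow> nat) set" where
  "compatible_perms lam j =
     {\<sigma>. \<sigma> permutes {1..n} \<and> exc n \<sigma> = j \<and> cycle_type n \<sigma> = lam \<and> compatible \<sigma>}"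

lemma finite_compatible_perms: "finite (compatible_perms lam j)"
  by (rule finite_subset[OF _ finite_permutations[of "{1..n}"]]) (auto simp: compatible_perms_def)

lemma exc_iso:
  assumes "iso \<rho> \<sigma> \<tau>" "\<sigma> permutes {1..n}" "\<tau> permutes {1..n}"
  shows "exc n \<tau> = exc n \<sigma>"
proof -
  have \<rho>: "\<rho> permutes {1..n}" using assms by (simp add: iso_def)
  have "EXC n \<tau> = \<rho> ` EXC n \<sigma>"
  proof (intro equalityI subsetI)
    fix i assume "i \<in> EXC n \<tau>"
    then have i: "i \<in> {1..n}" "\<tau> i > i" using EXC_eq[OF assms(3)] by auto
    have "inv \<rho> i \<in> {1..n}" using i(1) permutes_in_image[OF permutes_inv[OF \<rho>]] by blast
    moreover have "\<rho> (inv \<rho> i) = i" by (simp add: permutes_inverses[OF \<rho>])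
    ultimately have "inv \<rho> i \<in> EXC n \<sigma>"
      using assms(1) i(2) EXC_eq[OF assms(2)] unfolding iso_def
      by (metis (mono_tags, lifting) mem_Collect_eq)
    then show "i \<in> \<rho> ` EXC n \<sigma>" by (metis \<open>\<rho> (inv \<rho> i) = i\<close> imageI)
  next
    fix i assume "i \<in> \<rho> ` EXC n \<sigma>"
    then obtain j where j: "j \<in> {1..n}" "\<sigma> j > j" "i = \<rho> j" using EXC_eq[OF assms(2)] by auto
    moreover have "\<rho> j \<in> {1..n}" using j(1) permutes_in_image[OF \<rho>] by blast
    ultimately show "i \<in> EXC n \<tau>" using assms(1) EXC_eq[OF assms(3)] by (auto simp: iso_def)
  qed
  then show ?thesis
    using permutes_inj[OF \<rho>] by (simp add: exc_def card_image inj_on_subset[of _ UNIV])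
qed

text \<open>
  Invert and sort again. The result determines the isomorphism class of the inverse, hence that of
  the permutation, hence the permutation itself.
\<close>

lemma card_compatible_perms_le:
  "card (compatible_perms lam j) \<le> card (compatible_perms lam (n - count lam 1 - j))"
proof -
  have "\<exists>\<tau> \<rho>. \<tau> \<in> compatible_perms lam (n - count lam 1 - j) \<and> iso \<rho> (inv \<sigma>) \<tau>"
    if "\<sigma> \<in> compatible_perms lam j" for \<sigma>
  proof -
    have \<sigma>: "\<sigma> permutes {1..n}" "exc n \<sigma> = j" "cycle_type n \<sigma> = lam" "compatible \<sigma>"
      using that by (auto simp: compatible_perms_def)
    note inv = permutes_inv[OF \<sigma>(1)]
    obtain \<rho> where \<rho>: "iso \<rho> (inv \<sigma>) (\<rho> \<circ> inv \<sigma> \<circ> inv \<rho>)" "compatible (\<rho> \<circ> inv \<sigma> \<circ> inv \<rho>)"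
      using compatible_iso_exists[OF inv aperiodic_inv[OF \<sigma>(1) compatible_imp_aperiodic[OF \<sigma>(1,4)]]] .
    define \<tau> where "\<tau> = \<rho> \<circ> inv \<sigma> \<circ> inv \<rho>"
    have perm: "\<rho> permutes {1..n}" using \<rho>(1) by (simp add: iso_def)
    have \<tau>: "\<tau> permutes {1..n}" unfolding \<tau>_def
      by (rule permutes_compose[OF permutes_inv[OF perm] permutes_compose[OF inv perm]])
    have "exc n \<tau> = n - count lam 1 - j"
      using exc_iso[OF \<rho>(1) inv] \<tau> exc_inv[OF \<sigma>(1)] \<sigma>(2,3) by (simp add: \<tau>_def)
    moreover have "cycle_type n \<tau> = lam"
      using cycle_type_conjugate[OF perm] cycle_type_inv[OF \<sigma>(1)] \<sigma>(3) by (simp add: \<tau>_def)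
    ultimately have "\<tau> \<in> compatible_perms lam (n - count lam 1 - j)"
      using \<tau> \<rho>(2) by (simp add: compatible_perms_def \<tau>_def)
    then show ?thesis using \<rho>(1) unfolding \<tau>_def[symmetric] by blast
  qed
  then obtain \<Phi> where
    \<Phi>: "\<And>\<sigma>. \<sigma> \<in> compatible_perms lam j \<Longrightarrow> \<Phi> \<sigma> \<in> compatible_perms lam (n - count lam 1 - j)"
    and iso_\<Phi>: "\<And>\<sigma>. \<sigma> \<in> compatible_perms lam j \<Longrightarrow> \<exists>\<rho>. iso \<rho> (inv \<sigma>) (\<Phi> \<sigma>)"
    by metis
  have "inj_on \<Phi> (compatible_perms lam j)"
  proof (rule inj_onI)
    fix \<sigma> \<sigma>' assume mem: "\<sigma> \<in> compatible_perms lam j" "\<sigma>' \<in> compatible_perms lam j"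
      and "\<Phi> \<sigma> = \<Phi> \<sigma>'"
    then obtain \<rho> \<rho>' where "iso \<rho> (inv \<sigma>) (\<Phi> \<sigma>)" "iso \<rho>' (inv \<sigma>') (\<Phi> \<sigma>)" using iso_\<Phi> by metis
    then have "iso (inv \<rho>' \<circ> \<rho>) (inv \<sigma>) (inv \<sigma>')" by (blast intro: iso_trans iso_sym)
    moreover have \<sigma>: "\<sigma> permutes {1..n}" "\<sigma>' permutes {1..n}" "compatible \<sigma>" "compatible \<sigma>'"
      using mem by (auto simp: compatible_perms_def)
    ultimately have "iso (inv \<rho>' \<circ> \<rho>) \<sigma> \<sigma>'"
      using iso_inv permutes_inv permutes_inv_inv by metis
    then show "\<sigma> = \<sigma>'" using compatible_iso_unique \<sigma> by blast
  qed
  then show ?thesis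
    using \<Phi> by (intro card_inj_on_le[OF _ _ finite_compatible_perms]) auto
qed

lemma card_compatible_perms_symmetric:
  assumes "j \<le> n - count lam 1"
  shows "card (compatible_perms lam j) = card (compatible_perms lam (n - count lam 1 - j))"
proof (rule antisym)
  have "n - count lam 1 - (n - count lam 1 - j) = j" using assms by simp
  then show "card (compatible_perms lam (n - count lam 1 - j)) \<le> card (compatible_perms lam j)"
    using card_compatible_perms_le[of lam "n - count lam 1 - j"] by simp
qed (rule card_compatible_perms_le)

end

lemma F_seqs_decreasing_seq:
  assumes "s \<in> F_seqs {} n"
  shows "decreasing_seq n s"
proof
  fix i j assume ij: "i \<in> {1..n}" "j \<in> {1..n}" "i \<le> j"
  have step: "s (Suc j) \<le> s j" if "j \<in> {1..<n}" for j using assms that by (simp add: F_seqs_def)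
  show "s j \<le> s i"
    using ij(3) ij(1,2)
  proof (induction j rule: dec_induct)
    case (step j)
    then show ?case using \<open>\<And>j. j \<in> {1..<n} \<Longrightarrow> s (Suc j) \<le> s j\<close>[of j] by auto
  qed simp
qed

lemma Q_eq_sum_compatible_perms:
  "Q n lam j m = (\<Sum>s | s \<in> F_seqs {} n \<and> image_mset s (mset_set {1..n}) = m.
     int (card (decreasing_seq.compatible_perms n s lam j)))"
proof -
  let ?P = "{\<sigma>. \<sigma> permutes {1..n} \<and> exc n \<sigma> = j \<and> cycle_type n \<sigma> = lam}"
  let ?W = "{s. s \<in> F_seqs {} n \<and> image_mset s (mset_set {1..n}) = m}"
  have finP: "finite ?P" by (rule finite_subset[OF _ finite_permutations[of "{1..n}"]]) auto
  have finW: "finite ?W" using finite_F_seqs_monomial[of "{}" n m] by simp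
  have "Q n lam j m = (\<Sum>\<sigma>\<in>?P. \<Sum>s\<in>?W. if \<forall>i\<in>DEX n \<sigma>. s i > s (i + 1) then 1 else 0)"
    unfolding Q_def
  proof (intro sum.cong refl)
    fix \<sigma> assume "\<sigma> \<in> ?P"
    have "{s \<in> F_seqs (DEX n \<sigma>) n. image_mset s (mset_set {1..n}) = m} =
        {s \<in> ?W. \<forall>i\<in>DEX n \<sigma>. s i > s (i + 1)}"
      by (auto simp: F_seqs_def)
    then show "F (DEX n \<sigma>) n m = (\<Sum>s\<in>?W. if \<forall>i\<in>DEX n \<sigma>. s i > s (i + 1) then 1 else 0)"
      using finW by (simp add: F_def sum.If_cases Int_def)
  qed
  also have "\<dots> = (\<Sum>s\<in>?W. \<Sum>\<sigma>\<in>?P. if \<forall>i\<in>DEX n \<sigma>. s i > s (i + 1) then 1 else 0)"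
    by (rule sum.swap)
  also have "\<dots> = (\<Sum>s\<in>?W. int (card (decreasing_seq.compatible_perms n s lam j)))"
  proof (intro sum.cong refl)
    fix s assume "s \<in> ?W"
    then interpret decreasing_seq n s using F_seqs_decreasing_seq by simp
    have "compatible_perms lam j = {\<sigma> \<in> ?P. \<forall>i\<in>DEX n \<sigma>. s i > s (i + 1)}"
      by (auto simp: compatible_perms_def compatible_def)
    then show "(\<Sum>\<sigma>\<in>?P. if \<forall>i\<in>DEX n \<sigma>. s i > s (i + 1) then 1 else 0) = int (card (compatible_perms lam j))"
      using finP by (simp add: sum.If_cases Int_def)
  qed
  finally show ?thesis by simp
qed

theorem theorem5p9:
  fixes n k j :: nat and lam :: "nat multiset"
  assumes "n \<ge> 1"
    and "partition_of lam n"
    and "count lam 1 = k"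
    and "j \<le> n - k"
  shows "Q n lam j = Q n lam (n - k - j)"
proof
  fix m
  show "Q n lam j m = Q n lam (n - k - j) m"
    unfolding Q_eq_sum_compatible_perms
  proof (intro sum.cong refl)
    fix s assume "s \<in> {s. s \<in> F_seqs {} n \<and> image_mset s (mset_set {1..n}) = m}"
    then interpret decreasing_seq n s using F_seqs_decreasing_seq by simp
    show "int (card (compatible_perms lam j)) = int (card (compatible_perms lam (n - k - j)))"
      using card_compatible_perms_symmetric[of j lam] assms(3,4) by simp
  qed
qed

end
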